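(* For a positive integer $k$, let $n_k$ be the smallest non-negative integer $n$ such that the following holds: every set of $n$ distinct points in the plane $\mathbb{R}^2$ in general position (i.e. no four of them on a line or on a circle) contains $k$ points such that all the $\binom{k}{3}$ triples of these $k$ points determine circles of distinct radii. Then $n_k$ exists for every positive integer $k$, and $n_k = O(k^9)$; that is, there is an absolute constant $C>0$ such that $n_k\le C k^9$ for all positive integers $k$.
   Context: General position means that no four of the points lie on a common line and no four lie on a common circle (three collinear points are allowed). The circle determined by three non-collinear points is their circumscribed circle and its radius is their circumradius; a line is regarded as a circle of infinite radius, so a collinear triple determines a circle of radius $\infty$. "All triples determine circles of distinct radii" means that any two different (not necessarily disjoint) $3$-element subsets have different radii in $(0,\infty]$; for fewer than $4$ points this is vacuous. *)

theory Defs
  imports "HOL-Analysis.Analysis" "HOL-Library.Extended_Real"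
begin

definition concyclic :: "(real^2) set \<Rightarrow> bool" where
  "concyclic T \<longleftrightarrow> (\<exists>c r. 0 < r \<and> T \<subseteq> sphere c r)"

definition general_position :: "(real^2) set \<Rightarrow> bool" where
  "general_position S \<longleftrightarrow>
     (\<forall>T. T \<subseteq> S \<and> card T = 4 \<longrightarrow> \<not> collinear T \<and> \<not> concyclic T)"

text \<open>
  Only meant for three-element sets. A line counts as a circle of infinite radius;
  three non-collinear points of the plane lie on exactly one circle, so the
  description below is proper.
\<close>

definition circumradius :: "(real^2) set \<Rightarrow> ereal" where
  "circumradius T =
     (if collinear T then \<infinity> else ereal (THE r. \<exists>c. T \<subseteq> sphere c r))"

definition distinct_radii :: "(real^2) set \<Rightarrow> bool" where
  "distinct_radii K \<longleftrightarrow> inj_on circumradius {T. T \<subseteq> K \<and> card T = 3}"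

text \<open>
  Finiteness is required explicitly because infinite sets have cardinality 0 in HOL.
\<close>

definition forces_distinct_radii :: "nat \<Rightarrow> nat \<Rightarrow> bool" where
  "forces_distinct_radii k n \<longleftrightarrow>
     (\<forall>S. finite S \<and> card S = n \<and> general_position S \<longrightarrow>
        (\<exists>K. K \<subseteq> S \<and> finite K \<and> card K = k \<and> distinct_radii K))"

text \<open>
  The least-number operator is unspecified when no such \<open>n\<close> exists, so the existence of
  \<open>n\<^sub>k\<close> has to be asserted separately.
\<close>

definition n_min :: "nat \<Rightarrow> nat" where
  "n_min k = (LEAST n. forces_distinct_radii k n)"

end

(* The bound obtained is n_k <= 4 k^6. Given distinct points u, v of S and a radius rho, at most two
   further points x of S make the triangle u, v, x have circumradius rho: there are at most two
   circles of radius rho through u and v (one line if rho is infinite), and by general position each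
   of them contains at most one more point of S. So for a uniformly random k-tuple of points of S and
   two given triples of indices, the two radii coincide with probability at most 2/|S|: condition on
   all entries but one whose index lies in only one of the triples. A union bound over all pairs of
   triples, and over all pairs of indices for repeated points, leaves a k-tuple with distinct
   entries and distinct radii. *)
theory Submission
  imports Defs
begin

section \<open>Circles through two or three given points of the plane, in coordinates\<close>

lemma dist_sqr_2: "(dist x y)\<^sup>2 = (x$1 - y$1)\<^sup>2 + (x$2 - y$2)\<^sup>2" for x y :: "real^2"
  unfolding dist_norm power2_norm_eq_inner by (simp add: inner_vec_def sum_2 power2_eq_square)

lemma mem_sphere_2:
  fixes c x :: "real^2"
  assumes "0 \<le> r"
  shows "x \<in> sphere c r \<longleftrightarrow> (c$1 - x$1)\<^sup>2 + (c$2 - x$2)\<^sup>2 = r\<^sup>2"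
proof -
  have "x \<in> sphere c r \<longleftrightarrow> (dist c x)\<^sup>2 = r\<^sup>2"
    using assms by simp
  then show ?thesis by (simp only: dist_sqr_2)
qed

lemma collinear_3_cross:
  fixes u v x :: "real^2"
  assumes "(v$1 - u$1) * (x$2 - u$2) = (v$2 - u$2) * (x$1 - u$1)"
  shows "collinear {u, v, x}"
proof (cases "u = v")
  case False
  \<comment> \<open>\<open>t\<close> is the coefficient of the orthogonal projection of
    \<open>x - u\<close> onto \<open>v - u\<close>; the vanishing cross product makes
    \<open>x - u\<close> equal to its projection.\<close>
  define t where "t = ((x - u) \<bullet> (v - u)) / ((v - u) \<bullet> (v - u))"
  define N where "N = (v$1 - u$1)\<^sup>2 + (v$2 - u$2)\<^sup>2"
  have N: "N \<noteq> 0"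
    using False by (auto simp: N_def sum_power2_eq_zero_iff vec_eq_iff forall_2)
  have t: "t * N = (x$1 - u$1) * (v$1 - u$1) + (x$2 - u$2) * (v$2 - u$2)"
    using N by (simp add: t_def N_def inner_vec_def sum_2 power2_eq_square)
  have "N * (x$1 - u$1) = N * (t * (v$1 - u$1))"
    using t assms unfolding N_def by algebra
  moreover have "N * (x$2 - u$2) = N * (t * (v$2 - u$2))"
    using t assms unfolding N_def by algebra
  ultimately have "x$1 - u$1 = t * (v$1 - u$1)" "x$2 - u$2 = t * (v$2 - u$2)"
    using N by simp_all
  then have "x = t *\<^sub>R v + (1 - t) *\<^sub>R u"
    by (simp add: vec_eq_iff forall_2 algebra_simps)
  then have "collinear {v, x, u}"
    by (subst collinear_3_expand) blast
  then show ?thesis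
    by (simp add: insert_commute)
qed simp

text \<open>Justifies the \<open>THE\<close> in \<open>circumradius\<close>. Comparing squared
  distances from the centre to \<open>u\<close> and to each other vertex cancels the quadratic
  terms. What remains are two linear equations for the centre, with a unique solution because the
  cross product \<open>D\<close> is nonzero.\<close>

lemma circumradius_unique:
  fixes u v x :: "real^2"
  assumes "\<not> collinear {u, v, x}"
  shows "\<exists>!r. \<exists>c. {u, v, x} \<subseteq> sphere c r"
proof -
  define b1 b2 a1 a2 where ab: "b1 = v$1 - u$1" "b2 = v$2 - u$2" "a1 = x$1 - u$1" "a2 = x$2 - u$2"
  define D where "D = b1 * a2 - b2 * a1"
  have D: "D \<noteq> 0"
    using assms collinear_3_cross[of v u x] by (auto simp: D_def ab)
  have iff: "{u, v, x} \<subseteq> sphere c r \<longleftrightarrow>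
      r = dist c u \<and> 2 * ((c$1 - u$1) * b1 + (c$2 - u$2) * b2) = b1\<^sup>2 + b2\<^sup>2 \<and>
      2 * ((c$1 - u$1) * a1 + (c$2 - u$2) * a2) = a1\<^sup>2 + a2\<^sup>2" for c r
  proof -
    have "{u, v, x} \<subseteq> sphere c r \<longleftrightarrow>
        r = dist c u \<and> (dist c v)\<^sup>2 = (dist c u)\<^sup>2 \<and> (dist c x)\<^sup>2 = (dist c u)\<^sup>2"
      by auto
    also have "\<dots> \<longleftrightarrow> r = dist c u \<and> 2 * ((c$1 - u$1) * b1 + (c$2 - u$2) * b2) = b1\<^sup>2 + b2\<^sup>2 \<and>
      2 * ((c$1 - u$1) * a1 + (c$2 - u$2) * a2) = a1\<^sup>2 + a2\<^sup>2"
      unfolding dist_sqr_2 ab by (auto simp: power2_eq_square algebra_simps)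
    finally show ?thesis .
  qed
  \<comment> \<open>Cramer's rule for the linear system, with the origin moved to
    \<open>u\<close>.\<close>
  define c :: "real^2" where "c = vector
    [u$1 + (a2 * (b1\<^sup>2 + b2\<^sup>2) - b2 * (a1\<^sup>2 + a2\<^sup>2)) / (2 * D),
     u$2 + (b1 * (a1\<^sup>2 + a2\<^sup>2) - a1 * (b1\<^sup>2 + b2\<^sup>2)) / (2 * D)]"
  have c: "D * (2 * (c$1 - u$1)) = a2 * (b1\<^sup>2 + b2\<^sup>2) - b2 * (a1\<^sup>2 + a2\<^sup>2)"
    "D * (2 * (c$2 - u$2)) = b1 * (a1\<^sup>2 + a2\<^sup>2) - a1 * (b1\<^sup>2 + b2\<^sup>2)"
    using D by (simp_all add: c_def)
  have "D * (2 * ((c$1 - u$1) * b1 + (c$2 - u$2) * b2)) = D * (b1\<^sup>2 + b2\<^sup>2)"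
    using c D_def by algebra
  moreover have "D * (2 * ((c$1 - u$1) * a1 + (c$2 - u$2) * a2)) = D * (a1\<^sup>2 + a2\<^sup>2)"
    using c D_def by algebra
  ultimately have ex: "{u, v, x} \<subseteq> sphere c (dist c u)"
    using D by (subst iff) simp
  have "c' = c" if "{u, v, x} \<subseteq> sphere c' r" for c' r
  proof -
    have "2 * ((c'$1 - u$1) * b1 + (c'$2 - u$2) * b2) = b1\<^sup>2 + b2\<^sup>2"
      "2 * ((c'$1 - u$1) * a1 + (c'$2 - u$2) * a2) = a1\<^sup>2 + a2\<^sup>2"
      "2 * ((c$1 - u$1) * b1 + (c$2 - u$2) * b2) = b1\<^sup>2 + b2\<^sup>2"
      "2 * ((c$1 - u$1) * a1 + (c$2 - u$2) * a2) = a1\<^sup>2 + a2\<^sup>2"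
      using that ex unfolding iff by simp_all
    then have "D * (c'$1 - c$1) = 0" "D * (c'$2 - c$2) = 0"
      unfolding D_def by algebra+
    then show ?thesis using D by (simp add: vec_eq_iff forall_2)
  qed
  with ex show ?thesis
    by (metis iff)
qed

lemma circumradius_eq_ereal:
  assumes "circumradius {u, v, x} = ereal r"
  shows "\<exists>c. {u, v, x} \<subseteq> sphere c r"
proof -
  have "\<not> collinear {u, v, x}" "r = (THE r. \<exists>c. {u, v, x} \<subseteq> sphere c r)"
    using assms by (auto simp: circumradius_def split: if_splits)
  then show ?thesis
    using theI'[OF circumradius_unique] by blast
qed

text \<open>Once one centre \<open>c1\<close> is known, the only other candidate is its reflection
  \<open>u + v - c1\<close> in the midpoint of \<open>u\<close> and \<open>v\<close>. The two may
  coincide.\<close>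

lemma centres_of_circles_through_two_points:
  fixes u v :: "real^2"
  assumes "u \<noteq> v"
  shows "\<exists>c1 c2. \<forall>c. {u, v} \<subseteq> sphere c r \<longrightarrow> c = c1 \<or> c = c2"
proof (cases "\<exists>c1. {u, v} \<subseteq> sphere c1 r")
  case True
  then obtain c1 where c1: "{u, v} \<subseteq> sphere c1 r" ..
  have "c = c1 \<or> c = u + v - c1" if c: "{u, v} \<subseteq> sphere c r" for c
  proof -
    have r: "0 \<le> r" using c1 by auto
    define d1 d2 where d: "d1 = v$1 - u$1" "d2 = v$2 - u$2"
    have "d1\<^sup>2 + d2\<^sup>2 \<noteq> 0"
      using assms by (auto simp: d sum_power2_eq_zero_iff vec_eq_iff forall_2)
    have eqs: "(c1$1 - u$1)\<^sup>2 + (c1$2 - u$2)\<^sup>2 = r\<^sup>2" "(c1$1 - v$1)\<^sup>2 + (c1$2 - v$2)\<^sup>2 = r\<^sup>2"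
      "(c$1 - u$1)\<^sup>2 + (c$2 - u$2)\<^sup>2 = r\<^sup>2" "(c$1 - v$1)\<^sup>2 + (c$2 - v$2)\<^sup>2 = r\<^sup>2"
      using c c1 mem_sphere_2[OF r] by auto
    \<comment> \<open>\<open>p\<close> and \<open>q\<close> are the differences of \<open>c\<close>
      from the two candidates. Both are orthogonal to \<open>v - u\<close> since all centres lie on
      the perpendicular bisector, and \<open>p\<close> is orthogonal to \<open>q\<close> since both
      centres are equally far from the midpoint.\<close>
    define p1 p2 q1 q2 where pq: "p1 = c$1 - c1$1" "p2 = c$2 - c1$2"
      "q1 = c$1 + c1$1 - u$1 - v$1" "q2 = c$2 + c1$2 - u$2 - v$2"
    have p: "p1 * d1 + p2 * d2 = 0" and q: "q1 * d1 + q2 * d2 = 0" and pq0: "p1 * q1 + p2 * q2 = 0"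
      using eqs unfolding pq d by algebra+
    \<comment> \<open>In the plane, \<open>p\<close> and \<open>q\<close> are parallel, being
      orthogonal to the same nonzero vector. As they are also orthogonal to each other, every
      product of their coordinates vanishes, so one of them is zero.\<close>
    have "(d1\<^sup>2 + d2\<^sup>2) * (p1 * q1) = d2\<^sup>2 * (p1 * q1 + p2 * q2)"
      "(d1\<^sup>2 + d2\<^sup>2) * (p1 * q2) = - d1 * d2 * (p1 * q1 + p2 * q2)"
      "(d1\<^sup>2 + d2\<^sup>2) * (p2 * q1) = - d1 * d2 * (p1 * q1 + p2 * q2)"
      "(d1\<^sup>2 + d2\<^sup>2) * (p2 * q2) = d1\<^sup>2 * (p1 * q1 + p2 * q2)"
      using p q by algebra+
    then have "p1 * q1 = 0" "p1 * q2 = 0" "p2 * q1 = 0" "p2 * q2 = 0"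
      using \<open>d1\<^sup>2 + d2\<^sup>2 \<noteq> 0\<close> unfolding pq0 mult_zero_right mult_eq_0_iff by blast+
    then have "(p1 = 0 \<and> p2 = 0) \<or> (q1 = 0 \<and> q2 = 0)"
      by auto
    then show ?thesis
      by (auto simp: pq vec_eq_iff forall_2 algebra_simps)
  qed
  then show ?thesis by blast
qed auto

section \<open>Third vertices allowed by general position\<close>

lemma card_le_1_if_no_two:
  assumes "\<And>x y. x \<in> A \<Longrightarrow> y \<in> A \<Longrightarrow> x = y"
  shows "card A \<le> 1"
  using assms by (metis One_nat_def card_le_Suc0_iff_eq card.infinite zero_le)

lemma general_position_card_line:
  assumes "general_position S" "u \<in> S" "v \<in> S" "u \<noteq> v"
  shows "card {x \<in> S - {u, v}. collinear {u, v, x}} \<le> 1"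
proof (rule card_le_1_if_no_two, rule ccontr)
  fix x y
  assume x: "x \<in> {x \<in> S - {u, v}. collinear {u, v, x}}"
    and y: "y \<in> {x \<in> S - {u, v}. collinear {u, v, x}}" and "x \<noteq> y"
  then have "card {u, v, x, y} = 4" "{u, v, x, y} \<subseteq> S"
    using assms by auto
  moreover have "collinear {u, v, x, y}"
    using x y assms by (subst collinear_4_3) auto
  ultimately show False
    using assms(1) unfolding general_position_def by blast
qed

lemma general_position_card_circle:
  assumes "general_position S" "u \<in> S" "v \<in> S" "u \<noteq> v"
  shows "card {x \<in> S - {u, v}. {u, v, x} \<subseteq> sphere c r} \<le> 1"
proof (rule card_le_1_if_no_two, rule ccontr)
  fix x y
  assume x: "x \<in> {x \<in> S - {u, v}. {u, v, x} \<subseteq> sphere c r}"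
    and y: "y \<in> {x \<in> S - {u, v}. {u, v, x} \<subseteq> sphere c r}" and "x \<noteq> y"
  then have "card {u, v, x, y} = 4" "{u, v, x, y} \<subseteq> S" and sub: "{u, v, x, y} \<subseteq> sphere c r"
    using assms by auto
  \<comment> \<open>\<open>concyclic\<close> asks for a positive radius; a sphere of radius 0 could
    not contain both \<open>u\<close> and \<open>v\<close>.\<close>
  moreover have "0 < r"
  proof -
    have "u \<in> sphere c r" "v \<in> sphere c r" using sub by auto
    then show ?thesis
      using \<open>u \<noteq> v\<close> by (metis dist_eq_0_iff mem_sphere zero_less_dist_iff)
  qed
  ultimately show False
    using assms(1) unfolding general_position_def concyclic_def by blast
qed

text \<open>The link from geometry to counting: \<open>\<rho>\<close> will be the radius of another
  triple that stays fixed while \<open>x\<close> varies.\<close>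

lemma general_position_card_circumradius:
  assumes "finite S" "general_position S" "u \<in> S" "v \<in> S" "u \<noteq> v"
  shows "card {x \<in> S - {u, v}. circumradius {u, v, x} = \<rho>} \<le> 2"
proof (cases \<rho>)
  case (real r)
  let ?A = "\<lambda>c. {x \<in> S - {u, v}. {u, v, x} \<subseteq> sphere c r}"
  obtain c1 c2 where c: "\<And>c. {u, v} \<subseteq> sphere c r \<Longrightarrow> c = c1 \<or> c = c2"
    using centres_of_circles_through_two_points[OF assms(5)] by blast
  have "{x \<in> S - {u, v}. circumradius {u, v, x} = \<rho>} \<subseteq> ?A c1 \<union> ?A c2"
  proof
    fix x assume x: "x \<in> {x \<in> S - {u, v}. circumradius {u, v, x} = \<rho>}"
    then obtain c where "{u, v, x} \<subseteq> sphere c r"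
      using circumradius_eq_ereal real by blast
    with c[of c] x show "x \<in> ?A c1 \<union> ?A c2" by auto
  qed
  then have "card {x \<in> S - {u, v}. circumradius {u, v, x} = \<rho>} \<le> card (?A c1 \<union> ?A c2)"
    using assms(1) by (intro card_mono) auto
  also have "\<dots> \<le> card (?A c1) + card (?A c2)"
    by (rule card_Un_le)
  also have "\<dots> \<le> 2"
    using general_position_card_circle[OF assms(2-5), of c1 r]
      general_position_card_circle[OF assms(2-5), of c2 r] by linarith
  finally show ?thesis .
next
  case PInf
  \<comment> \<open>A non-collinear triple has a real value of \<open>circumradius\<close>, so
    infinity singles out the points of the line through \<open>u\<close> and
    \<open>v\<close>.\<close>
  then have "{x \<in> S - {u, v}. circumradius {u, v, x} = \<rho>} = {x \<in> S - {u, v}. collinear {u, v, x}}"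
    by (auto simp: circumradius_def)
  then show ?thesis
    using general_position_card_line[OF assms(2-5)] by simp
next
  case MInf
  then have "{x \<in> S - {u, v}. circumradius {u, v, x} = \<rho>} = {}"
    by (auto simp: circumradius_def)
  then show ?thesis by (metis card.empty zero_le)
qed

section \<open>Counting bad tuples, one free coordinate at a time\<close>

text \<open>Conditioning in counting form: a tuple is given by its entries away from
  \<open>d\<close> together with the entry \<open>x\<close> at \<open>d\<close>, and at most
  \<open>m\<close> values of \<open>x\<close> are bad for each choice of the others.\<close>

lemma card_PiE_fibre_le:
  assumes "finite I" "finite S" "d \<in> I"
    and fibre: "\<And>f. f \<in> (I - {d}) \<rightarrow>\<^sub>E S \<Longrightarrow> card {x \<in> S. P (f(d := x))} \<le> m"
  shows "card {f \<in> I \<rightarrow>\<^sub>E S. P f} \<le> m * card S ^ (card I - 1)"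
proof -
  let ?G = "(I - {d}) \<rightarrow>\<^sub>E S"
  let ?h = "\<lambda>(f, x). f(d := x)"
  have "{f \<in> I \<rightarrow>\<^sub>E S. P f} \<subseteq> ?h ` (SIGMA f:?G. {x \<in> S. P (f(d := x))})"
  proof
    fix f assume f: "f \<in> {f \<in> I \<rightarrow>\<^sub>E S. P f}"
    \<comment> \<open>Extensional functions take the value \<open>undefined\<close> off their
      domain, so this is the restriction of \<open>f\<close> to \<open>I - {d}\<close>.\<close>
    then have "f(d := undefined) \<in> ?G" "f d \<in> S"
      using assms(3) by (auto simp: PiE_iff extensional_def)
    with f show "f \<in> ?h ` (SIGMA f:?G. {x \<in> S. P (f(d := x))})"
      by (intro image_eqI[of _ _ "(f(d := undefined), f d)"]) auto
  qed
  moreover have fin: "finite ?G"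
    using assms by (intro finite_PiE) auto
  ultimately have "card {f \<in> I \<rightarrow>\<^sub>E S. P f} \<le> card (SIGMA f:?G. {x \<in> S. P (f(d := x))})"
    using assms(2) by (intro surj_card_le) auto
  also have "\<dots> = (\<Sum>f\<in>?G. card {x \<in> S. P (f(d := x))})"
    using fin assms(2) by (intro card_SigmaI) auto
  also have "\<dots> \<le> (\<Sum>f\<in>?G. m)"
    by (intro sum_mono fibre)
  also have "\<dots> = m * card S ^ (card I - 1)"
    using assms by (simp add: card_PiE card_Diff_singleton)
  finally show ?thesis .
qed

lemma card_tuples_equal_radii:
  assumes "finite I" "finite S" "general_position S"
    and T: "T \<subseteq> I" "card T = 3" "U \<subseteq> I" "card U = 3" "T \<noteq> U"
  shows "card {f \<in> I \<rightarrow>\<^sub>E S. inj_on f I \<and> circumradius (f ` T) = circumradius (f ` U)}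
    \<le> 2 * card S ^ (card I - 1)"
proof -
  have fin: "finite T" "finite U"
    using T assms(1) finite_subset by auto
  \<comment> \<open>Equal cardinalities turn inclusion into equality.\<close>
  have "\<not> U \<subseteq> T"
    using T fin card_subset_eq by metis
  then obtain d where d: "d \<in> U" "d \<notin> T" by blast
  then have "card (U - {d}) = 2"
    using T(4) fin by simp
  then obtain p q where pq: "U - {d} = {p, q}" "p \<noteq> q"
    by (auto simp: card_2_iff)
  then have U: "U = {p, q, d}" "p \<noteq> d" "q \<noteq> d" "p \<in> I" "q \<in> I" "d \<in> I"
    using d T(3) by auto
  show ?thesis
  proof (rule card_PiE_fibre_le[OF assms(1,2) U(6)])
    fix f assume f: "f \<in> (I - {d}) \<rightarrow>\<^sub>E S"
    let ?A = "{x \<in> S. inj_on (f(d := x)) I \<and>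
      circumradius ((f(d := x)) ` T) = circumradius ((f(d := x)) ` U)}"
    have fpq: "f p \<in> S" "f q \<in> S"
      using f U by auto
    have fd: "f p \<noteq> f q \<and> x \<noteq> f p \<and> x \<noteq> f q" if "inj_on (f(d := x)) I" for x
      using that U pq(2) unfolding inj_on_def by (metis fun_upd_apply)
    have fT: "(f(d := x)) ` T = f ` T" for x
      using d(2) by auto
    have fU: "(f(d := x)) ` U = {f p, f q, x}" for x
      using U by auto
    show "card ?A \<le> 2"
    \<comment> \<open>The fibre bound ranges over all partial tuples, including those that already
      repeat a point; no injective tuple extends such a one.\<close>
    proof (cases "f p = f q")
      case True
      then have "?A = {}" using fd by auto
      then show ?thesis by (metis card.empty zero_le)
    next
      case False
      have "?A \<subseteq> {x \<in> S - {f p, f q}. circumradius {f p, f q, x} = circumradius (f ` T)}"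
        unfolding fT fU using fd by auto
      then have "card ?A \<le> card {x \<in> S - {f p, f q}.
          circumradius {f p, f q, x} = circumradius (f ` T)}"
        using assms(2) by (intro card_mono) auto
      also have "\<dots> \<le> 2"
        using general_position_card_circumradius assms fpq False by blast
      finally show ?thesis .
    qed
  qed
qed

lemma card_tuples_collision:
  assumes "finite I" "finite S" "i \<in> I" "j \<in> I" "i \<noteq> j"
  shows "card {f \<in> I \<rightarrow>\<^sub>E S. f i = f j} \<le> card S ^ (card I - 1)"
proof -
  have "card {f \<in> I \<rightarrow>\<^sub>E S. f i = f j} \<le> 1 * card S ^ (card I - 1)"
    using assms by (intro card_PiE_fibre_le[of _ _ i] card_le_1_if_no_two) auto
  then show ?thesis by simp
qed

section \<open>From triples of indices to triples of points, and the union bound\<close>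

lemma distinct_radii_image:
  assumes "inj_on f I"
    and "\<And>T U. T \<subseteq> I \<Longrightarrow> card T = 3 \<Longrightarrow> U \<subseteq> I \<Longrightarrow> card U = 3 \<Longrightarrow> T \<noteq> U \<Longrightarrow>
      circumradius (f ` T) \<noteq> circumradius (f ` U)"
  shows "distinct_radii (f ` I)"
  unfolding distinct_radii_def
proof (rule inj_onI)
  fix A B
  assume A: "A \<in> {T. T \<subseteq> f ` I \<and> card T = 3}" and B: "B \<in> {T. T \<subseteq> f ` I \<and> card T = 3}"
    and eq: "circumradius A = circumradius B"
  obtain T U where "T \<subseteq> I" "A = f ` T" "U \<subseteq> I" "B = f ` U"
    using A B by (auto simp: subset_image_iff)
  \<comment> \<open>Injectivity of \<open>f\<close> pulls three-point sets back to three-index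
    sets.\<close>
  moreover from this have "card T = 3" "card U = 3"
    using A B card_image[OF inj_on_subset[OF assms(1)]] by auto
  ultimately show "A = B"
    using assms(2) eq by blast
qed

text \<open>In the threshold, \<open>2 * k ^ 6\<close> pays for the pairs of triples, each with at
  most 2 bad values of the free entry, and \<open>k\<^sup>2\<close> for the ordered pairs of
  indices, each with at most one.\<close>

lemma general_position_contains_distinct_radii:
  assumes "finite S" "general_position S" and large: "2 * k ^ 6 + k\<^sup>2 < card S"
  shows "\<exists>K. K \<subseteq> S \<and> finite K \<and> card K = k \<and> distinct_radii K"
proof -
  define I where "I = {..<k}"
  define n where "n = card S"
  define F where "F = I \<rightarrow>\<^sub>E S"
  define Tr where "Tr = {T. T \<subseteq> I \<and> card T = 3}"
  define C where "C = (\<lambda>(i, j). {f \<in> F. f i = f j})"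
  \<comment> \<open>Tuples with repeated entries are excluded here, since the sets \<open>C\<close>
    already account for them.\<close>
  define E where "E = (\<lambda>(T, U). {f \<in> F. inj_on f I \<and> circumradius (f ` T) = circumradius (f ` U)})"
  define X where "X = {(i, j) \<in> I \<times> I. i \<noteq> j}"
  define Y where "Y = {(T, U) \<in> Tr \<times> Tr. T \<noteq> U}"
  have I: "finite I" "card I = k" by (simp_all add: I_def)
  have finTr: "finite Tr" using I by (simp add: Tr_def)
  have finF: "finite F" and cardF: "card F = n ^ k"
    using I assms(1) by (auto simp: F_def n_def card_PiE intro: finite_PiE)
  have finXY: "finite X" "finite Y"
    using I finTr by (auto simp: X_def Y_def intro: finite_subset[of _ "I \<times> I"] finite_subset[of _ "Tr \<times> Tr"])
  have "card Tr = k choose 3"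
    using n_subsets[OF I(1), of 3] I(2) by (simp add: Tr_def)
  also have "\<dots> \<le> k ^ 3"
    by (cases "3 \<le> k") (simp_all add: binomial_le_pow binomial_eq_0)
  finally have cardTr: "card Tr \<le> k ^ 3" .
  have "card X \<le> card (I \<times> I)"
    unfolding X_def by (intro card_mono) (use I in auto)
  then have cardX: "card X \<le> k\<^sup>2"
    by (simp add: I power2_eq_square)
  have "card Y \<le> card (Tr \<times> Tr)"
    unfolding Y_def by (intro card_mono) (use finTr in auto)
  also have "\<dots> \<le> k ^ 3 * k ^ 3"
    unfolding card_cartesian_product using cardTr by (intro mult_mono) auto
  finally have cardY: "card Y \<le> k ^ 6"
    by (simp flip: power_add)
  have "\<exists>f\<in>F. f \<notin> (\<Union>x\<in>X. C x) \<and> f \<notin> (\<Union>y\<in>Y. E y)"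
  \<comment> \<open>Truncated subtraction breaks \<open>n * n ^ (k - 1) = n ^ k\<close> at 0; there
    the empty tuple is good, as \<open>X\<close> and \<open>Y\<close> are empty.\<close>
  proof (cases "k = 0")
    case True
    then show ?thesis
      by (auto simp: F_def I_def X_def Y_def Tr_def)
  next
    case False
    have "card (\<Union>x\<in>X. C x) \<le> (\<Sum>x\<in>X. card (C x))"
      by (intro card_UN_le finXY)
    also have "\<dots> \<le> (\<Sum>x\<in>X. n ^ (k - 1))"
      using card_tuples_collision[OF I(1) assms(1)]
      by (intro sum_mono) (auto simp: X_def C_def F_def I n_def)
    also have "\<dots> \<le> k\<^sup>2 * n ^ (k - 1)"
      using cardX by simp
    finally have 1: "card (\<Union>x\<in>X. C x) \<le> k\<^sup>2 * n ^ (k - 1)" .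
    have "card (\<Union>y\<in>Y. E y) \<le> (\<Sum>y\<in>Y. card (E y))"
      by (intro card_UN_le finXY)
    also have "\<dots> \<le> (\<Sum>y\<in>Y. 2 * n ^ (k - 1))"
      using card_tuples_equal_radii[OF I(1) assms(1,2)]
      by (intro sum_mono) (auto simp: Y_def E_def F_def Tr_def I n_def)
    also have "\<dots> \<le> k ^ 6 * (2 * n ^ (k - 1))"
      using cardY by simp
    finally have 2: "card (\<Union>y\<in>Y. E y) \<le> k ^ 6 * (2 * n ^ (k - 1))" .
    have "card ((\<Union>x\<in>X. C x) \<union> (\<Union>y\<in>Y. E y)) \<le> (2 * k ^ 6 + k\<^sup>2) * n ^ (k - 1)"
      using card_Un_le[of "\<Union>x\<in>X. C x" "\<Union>y\<in>Y. E y"] 1 2 by (simp add: algebra_simps)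
    also have "\<dots> < n * n ^ (k - 1)"
      using large by (intro mult_strict_right_mono) (auto simp: n_def)
    also have "\<dots> = card F"
      using False cardF by (simp flip: power_Suc)
    finally have "\<not> F \<subseteq> (\<Union>x\<in>X. C x) \<union> (\<Union>y\<in>Y. E y)"
      using finF finXY card_mono[of "(\<Union>x\<in>X. C x) \<union> (\<Union>y\<in>Y. E y)" F]
      by (auto simp: C_def E_def split_beta not_le)
    then show ?thesis by blast
  qed
  then obtain f where f: "f \<in> F" "f \<notin> (\<Union>x\<in>X. C x)" "f \<notin> (\<Union>y\<in>Y. E y)"
    by blast
  have inj: "inj_on f I"
    using f(1,2) by (auto simp: X_def C_def inj_on_def)
  then have "distinct_radii (f ` I)"
    using f(1,3) by (intro distinct_radii_image) (auto simp: Y_def E_def Tr_def)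
  moreover have "f ` I \<subseteq> S" "card (f ` I) = k"
    using f(1) inj I by (auto simp: F_def card_image)
  ultimately show ?thesis
    using I(1) by blast
qed

lemma forces_distinct_radii_pow6:
  assumes "k \<ge> 1"
  shows "forces_distinct_radii k (4 * k ^ 6)"
proof -
  have "k\<^sup>2 \<le> k ^ 6" "0 < k ^ 6"
    using assms by (auto intro: power_increasing)
  \<comment> \<open>The left side is at most \<open>3 * k ^ 6\<close>; the factor 4 makes the
    inequality strict.\<close>
  then have "2 * k ^ 6 + k\<^sup>2 < 4 * k ^ 6"
    by linarith
  then show ?thesis
    unfolding forces_distinct_radii_def using general_position_contains_distinct_radii by metis
qed

theorem theorem1p1:
  "(\<forall>k\<ge>1. \<exists>n. forces_distinct_radii k n) \<and>
   (\<exists>C::real. C > 0 \<and> (\<forall>k\<ge>1. real (n_min k) \<le> C * real k ^ 9))"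
proof
  show "\<forall>k\<ge>1. \<exists>n. forces_distinct_radii k n"
    using forces_distinct_radii_pow6 by blast
  have "real (n_min k) \<le> 4 * real k ^ 9" if "k \<ge> 1" for k
  proof -
    have "n_min k \<le> 4 * k ^ 6"
      unfolding n_min_def by (rule Least_le) (rule forces_distinct_radii_pow6[OF that])
    \<comment> \<open>The sixth-power bound is weakened to the ninth power, using
      \<open>k \<ge> 1\<close>.\<close>
    also have "\<dots> \<le> 4 * k ^ 9"
      using that by (simp add: power_increasing)
    finally have "real (n_min k) \<le> real (4 * k ^ 9)"
      by (rule of_nat_mono)
    then show ?thesis by simp
  qed
  then show "\<exists>C::real. C > 0 \<and> (\<forall>k\<ge>1. real (n_min k) \<le> C * real k ^ 9)"
    by (intro exI[of _ 4]) auto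
qed

end
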